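(* Let $A=[a_1~\cdots~a_n]\in\mathbb{N}^{m\times n}$. The cosine Chebyshev variety $\mathcal{X}_{A,\cos}\subset\mathbb{C}^n$ is irreducible of dimension equal to $\operatorname{rank}(A)$. In particular, it is the Zariski closure of the projection to $\mathbb{C}^n$ (the $x$-coordinates) of the variety $$\mathcal{V}=\{(x,y)\in\mathbb{C}^n\times(\mathbb{C}^* )^n\ :\ y\in\mathcal{Y}_A,\ \ y_j^2-2x_jy_j+1=0\ \text{ for } j=1,\ldots,n\}.$$
   Context: For $A\in\mathbb{N}^{m\times n}$ with columns $a_1,\ldots,a_n$, the cosine Chebyshev variety $\mathcal{X}_{A,\cos}\subset\mathbb{C}^n$ is the Zariski closure of the image of the map $\mathbb{C}^m\to\mathbb{C}^n$, $u\mapsto(\cos(a_1\cdot u),\ldots,\cos(a_n\cdot u))$, where $a_j\cdot u=a_{1j}u_1+\cdots+a_{mj}u_m$. The affine toric variety $\mathcal{Y}_A\subset\mathbb{C}^n$ is the Zariski closure of the image of the monomial map $\Phi_A:\mathbb{C}^m\to\mathbb{C}^n$, $t\mapsto(t^{a_1},\ldots,t^{a_n})$, where $t^{a_j}=t_1^{a_{1j}}\cdots t_m^{a_{mj}}$. $\mathbb{C}^*=\mathbb{C}\setminus\{0\}$. *)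

theory Defs
  imports "HOL-Analysis.Analysis" "HOL-Library.Poly_Mapping"
begin

text \<open>
  A polynomial is a finitely supported map from exponent vectors to coefficients; the
  multiplication that comes with \<open>\<Rightarrow>\<^sub>0\<close> is the multiplication of polynomials.
\<close>

type_synonym 'n cpoly = "('n \<Rightarrow>\<^sub>0 nat) \<Rightarrow>\<^sub>0 complex"

definition poly_eval :: "'n::finite cpoly \<Rightarrow> complex^'n \<Rightarrow> complex" where
  "poly_eval p x = (\<Sum>\<alpha>\<in>Poly_Mapping.keys p.
     Poly_Mapping.lookup p \<alpha> * (\<Prod>j\<in>UNIV. x $ j ^ Poly_Mapping.lookup \<alpha> j))"

definition zero_locus :: "'n::finite cpoly set \<Rightarrow> (complex^'n) set" where
  "zero_locus P = {x. \<forall>p\<in>P. poly_eval p x = 0}"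

lemma poly_eval_superset:
  assumes "finite S" "Poly_Mapping.keys p \<subseteq> S"
  shows "poly_eval p x = (\<Sum>\<alpha>\<in>S.
     Poly_Mapping.lookup p \<alpha> * (\<Prod>j\<in>UNIV. x $ j ^ Poly_Mapping.lookup \<alpha> j))"
  unfolding poly_eval_def using assms
  by (intro sum.mono_neutral_left) (auto simp: in_keys_iff)

lemma poly_eval_0 [simp]: "poly_eval 0 x = 0"
  by (simp add: poly_eval_def)

lemma poly_eval_single [simp]:
  "poly_eval (Poly_Mapping.single \<alpha> c) x = c * (\<Prod>j\<in>UNIV. x $ j ^ Poly_Mapping.lookup \<alpha> j)"
  by (subst poly_eval_superset[of "{\<alpha>}"]) auto

lemma poly_eval_1 [simp]: "poly_eval 1 x = 1"
  by (simp flip: single_one)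

lemma poly_eval_add [simp]: "poly_eval (p + q) x = poly_eval p x + poly_eval q x"
proof -
  let ?S = "Poly_Mapping.keys p \<union> Poly_Mapping.keys q"
  have "Poly_Mapping.keys (p + q) \<subseteq> ?S"
    by (rule Poly_Mapping.keys_add)
  then show ?thesis
    by (simp add: poly_eval_superset[of ?S] lookup_add distrib_right sum.distrib)
qed

lemma poly_eval_sum: "poly_eval (\<Sum>i\<in>I. f i) x = (\<Sum>i\<in>I. poly_eval (f i) x)"
  by (induction I rule: infinite_finite_induct) auto

lemma cpoly_eq_sum_single:
  "p = (\<Sum>\<alpha>\<in>Poly_Mapping.keys p. Poly_Mapping.single \<alpha> (Poly_Mapping.lookup p \<alpha>))"
  by (rule poly_mapping_eqI) (simp add: lookup_sum lookup_single when_def in_keys_iff)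

lemma poly_eval_mult [simp]: "poly_eval (p * q) x = poly_eval p x * poly_eval q x"
proof -
  have "p * q = (\<Sum>\<alpha>\<in>Poly_Mapping.keys p. Poly_Mapping.single \<alpha> (Poly_Mapping.lookup p \<alpha>)) *
      (\<Sum>\<beta>\<in>Poly_Mapping.keys q. Poly_Mapping.single \<beta> (Poly_Mapping.lookup q \<beta>))"
    by (metis cpoly_eq_sum_single)
  also have "\<dots> = (\<Sum>\<alpha>\<in>Poly_Mapping.keys p. \<Sum>\<beta>\<in>Poly_Mapping.keys q.
      Poly_Mapping.single (\<alpha> + \<beta>) (Poly_Mapping.lookup p \<alpha> * Poly_Mapping.lookup q \<beta>))"
    by (simp add: sum_product mult_single)
  finally have "poly_eval (p * q) x =
      (\<Sum>\<alpha>\<in>Poly_Mapping.keys p. \<Sum>\<beta>\<in>Poly_Mapping.keys q.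
        Poly_Mapping.lookup p \<alpha> * Poly_Mapping.lookup q \<beta> *
        (\<Prod>j\<in>UNIV. x $ j ^ (Poly_Mapping.lookup (\<alpha> + \<beta>) j)))"
    by (simp only: poly_eval_sum poly_eval_single)
  then show ?thesis
    by (simp add: poly_eval_def sum_product lookup_add power_add prod.distrib mult_ac)
qed

definition zariski :: "(complex^'n::finite) topology" where
  "zariski = topology (\<lambda>U. \<exists>P. U = - zero_locus P)"

lemma istopology_zariski: "istopology (\<lambda>U. \<exists>P. U = - zero_locus P)"
proof -
  have "\<exists>R. - zero_locus P \<inter> - zero_locus Q = - zero_locus R" for P Q :: "'a cpoly set"
  proof (intro exI equalityI)
    let ?R = "(\<lambda>(p, q). p * q) ` (P \<times> Q)"
    show "- zero_locus P \<inter> - zero_locus Q \<subseteq> - zero_locus ?R"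
      by (force simp: zero_locus_def)
    show "- zero_locus ?R \<subseteq> - zero_locus P \<inter> - zero_locus Q"
      by (auto simp: zero_locus_def)
  qed
  moreover have "\<exists>R. \<Union>\<K> = - zero_locus R"
    if opens: "\<forall>U\<in>\<K>. \<exists>P. U = - zero_locus P" for \<K> :: "(complex^'a) set set"
  proof -
    obtain P where P: "\<forall>U\<in>\<K>. U = - zero_locus (P U)"
      using bchoice[OF opens] ..
    then have "\<Union>\<K> = (\<Union>U\<in>\<K>. - zero_locus (P U))"
      by (metis (no_types, lifting) SUP_cong image_ident)
    also have "\<dots> = - zero_locus (\<Union>U\<in>\<K>. P U)"
      by (auto simp: zero_locus_def)
    finally show ?thesis ..
  qed
  ultimately show ?thesis
    unfolding istopology_def by clarsimp
qed

lemma openin_zariski: "openin zariski U \<longleftrightarrow> (\<exists>P. U = - zero_locus P)"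
  by (simp add: zariski_def topology_inverse'[OF istopology_zariski])

lemma topspace_zariski [simp]: "topspace zariski = UNIV"
proof -
  have "openin zariski (UNIV :: (complex^'n) set)"
    unfolding openin_zariski by (rule exI[of _ "{1}"]) (auto simp: zero_locus_def)
  then show ?thesis
    using openin_subset by blast
qed

lemma closedin_zariski: "closedin zariski V \<longleftrightarrow> (\<exists>P. V = zero_locus P)"
  unfolding closedin_def openin_zariski topspace_zariski
  by (metis Compl_eq_Diff_UNIV double_complement subset_UNIV)

definition irreducible_space :: "'a topology \<Rightarrow> bool" where
  "irreducible_space X \<longleftrightarrow> topspace X \<noteq> {} \<and>
     (\<forall>C D. closedin X C \<longrightarrow> closedin X D \<longrightarrow> topspace X = C \<union> D
        \<longrightarrow> topspace X = C \<or> topspace X = D)"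

text \<open>
  The Krull dimension: the supremum of the lengths \<open>k\<close> of strictly increasing chains
  \<open>Z\<^sub>0 \<subset> \<dots> \<subset> Z\<^sub>k\<close> of irreducible closed subsets. With values in \<^typ>\<open>enat\<close> the
  empty space gets dimension 0.
\<close>

definition krull_dim :: "'a topology \<Rightarrow> enat" where
  "krull_dim X = (SUP k \<in> {k. \<exists>Z :: nat \<Rightarrow> 'a set.
       (\<forall>i\<le>k. closedin X (Z i) \<and> irreducible_space (subtopology X (Z i))) \<and>
       (\<forall>i<k. Z i \<subset> Z (Suc i))}. enat k)"

text \<open>
  For \<open>A :: nat^'n^'m\<close>, with \<open>m\<close> rows and \<open>n\<close> columns, the entry \<open>a\<^sub>i\<^sub>j\<close> is \<open>A $ i $ j\<close>.
\<close>

definition cos_map :: "nat^'n^'m \<Rightarrow> complex^'m \<Rightarrow> complex^'n" where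
  "cos_map A u = (\<chi> j. cos (\<Sum>i\<in>UNIV. of_nat (A $ i $ j) * u $ i))"

definition monomial_map :: "nat^'n^'m \<Rightarrow> complex^'m \<Rightarrow> complex^'n" where
  "monomial_map A t = (\<chi> j. \<Prod>i\<in>UNIV. t $ i ^ (A $ i $ j))"

definition cos_chebyshev_variety :: "nat^'n^'m \<Rightarrow> (complex^'n) set" where
  "cos_chebyshev_variety A = zariski closure_of range (cos_map A)"

definition affine_toric_variety :: "nat^'n^'m \<Rightarrow> (complex^'n) set" where
  "affine_toric_variety A = zariski closure_of range (monomial_map A)"

definition toric_cover :: "nat^'n^'m \<Rightarrow> ((complex^'n) \<times> (complex^'n)) set" where
  "toric_cover A = {(x, y). (\<forall>j. y $ j \<noteq> 0) \<and> y \<in> affine_toric_variety A \<and>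
     (\<forall>j. (y $ j)\<^sup>2 - 2 * x $ j * y $ j + 1 = 0)}"

end

theory Submission
  imports Defs "HOL-Complex_Analysis.Conformal_Mappings"
begin

text \<open>
  Every polynomial pulled back along \<^const>\<open>cos_map\<close> is an entire function on \<open>\<complex>\<^sup>m\<close>, and a
  product of two entire functions vanishes only if one factor does; restricting to a complex
  line reduces this to one variable. Hence the polynomials that vanish on the image form a
  prime ideal, and the closure is irreducible. The same argument applies to the image of every
  complex subspace of \<open>\<complex>\<^sup>m\<close>.

  The dimension is at least the rank \<open>r\<close>: the subspaces on which all but the first \<open>k\<close> of \<open>r\<close>
  independent linear forms \<open>a\<^sub>j \<cdot> u\<close> vanish have irreducible image closures
  (\<open>prime_vanishing_ideal_cos_map\<close>), and these increase strictly with \<open>k\<close>, because on the \<open>k\<close>-th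
  of them the next coordinate \<open>cos (a\<^sub>j \<cdot> u)\<close> is constantly 1, and on the following one it is not.

  The dimension is at most \<open>r\<close>: along a chain of \<open>k + 1\<close> irreducible closed sets each step
  contributes one more algebraically independent polynomial (\<open>chain_alg_independent\<close>), so such a
  chain yields \<open>k\<close> polynomials algebraically independent on the variety. The monomials in these
  polynomials with all exponents at most \<open>N\<close> number \<open>(N + 1)\<^sup>k\<close>. After substituting the cosines
  they are combinations of exponentials \<open>exp (\<i> b \<cdot> u)\<close> with \<open>b = A c\<close> and \<open>c\<close> an integer vector
  of size \<open>O(N)\<close>; as \<open>b\<close> lies in a space of dimension \<open>r\<close>, only \<open>O(N\<^sup>r)\<close> of them occur. For
  large \<open>N\<close> independence forces \<open>k \<le> r\<close> (\<open>alg_independent_le_rank\<close>).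

  For the projection, \<open>y\<^sup>2 - 2 x y + 1 = 0\<close> says that \<open>x = (y + 1/y) / 2\<close>, the relation between
  \<open>cos z\<close> and \<open>exp (\<i> z)\<close>. So the projection contains the image of \<^const>\<open>cos_map\<close>. Conversely,
  if \<open>p\<close> vanishes on that image then \<open>p ((y + 1/y) / 2)\<close>, cleared of denominators, is a polynomial
  in \<open>y\<close> that vanishes on the torus points of the monomial parametrization, and therefore on the
  torus points of the toric variety.
\<close>

section \<open>Polynomial functions and the Zariski closure\<close>

text \<open>
  An induction principle: whatever holds for constants and for the components of a map, and is
  preserved by sums and products, holds for the pullback of every polynomial along that map. It
  is used below with holomorphy, with trigonometric sums, and with Laurent polynomials.
\<close>

lemma poly_eval_closed_class:
  fixes h :: "'a \<Rightarrow> complex^'n"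
  assumes const: "\<And>c. P (\<lambda>_. c)"
    and add: "\<And>f g. P f \<Longrightarrow> P g \<Longrightarrow> P (\<lambda>u. f u + g u)"
    and mult: "\<And>f g. P f \<Longrightarrow> P g \<Longrightarrow> P (\<lambda>u. f u * g u)"
    and gen: "\<And>j. P (\<lambda>u. h u $ j)"
  shows "P (\<lambda>u. poly_eval p (h u))"
proof -
  have sum: "P (\<lambda>u. \<Sum>i\<in>I. f i u)" if "\<And>i. P (f i)"
    for I :: "('n \<Rightarrow>\<^sub>0 nat) set" and f :: "('n \<Rightarrow>\<^sub>0 nat) \<Rightarrow> 'a \<Rightarrow> complex"
    by (induction I rule: infinite_finite_induct) (auto intro: const add that)
  have prod: "P (\<lambda>u. \<Prod>i\<in>I. f i u)" if "\<And>i. P (f i)"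
    for I :: "'n set" and f :: "'n \<Rightarrow> 'a \<Rightarrow> complex"
    by (induction I rule: infinite_finite_induct) (auto intro: const mult that)
  have pow: "P (\<lambda>u. f u ^ k)" if "P f" for f and k :: nat
    by (induction k) (auto intro: const mult that)
  show ?thesis
    unfolding poly_eval_def by (intro sum mult prod pow const gen)
qed

definition coord :: "'n::finite \<Rightarrow> 'n cpoly" where
  "coord j = Poly_Mapping.single (Poly_Mapping.single j 1) 1"

lemma poly_eval_coord [simp]: "poly_eval (coord j) x = x $ j"
proof -
  have "(\<Prod>i\<in>UNIV. x $ i ^ Poly_Mapping.lookup (Poly_Mapping.single j 1) i) =
      (\<Prod>i\<in>UNIV. if i = j then x $ j else 1)"
    by (intro prod.cong) (auto simp: lookup_single when_def)
  then show ?thesis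
    by (simp add: coord_def prod.delta)
qed

definition const_poly :: "complex \<Rightarrow> 'n::finite cpoly" where
  "const_poly c = Poly_Mapping.single 0 c"

lemma poly_eval_const_poly [simp]: "poly_eval (const_poly c) x = c"
  by (simp add: const_poly_def)

lemma poly_eval_power [simp]: "poly_eval (p ^ k) x = poly_eval p x ^ k"
  by (induction k) auto

lemma poly_eval_prod: "poly_eval (\<Prod>i\<in>I. f i) x = (\<Prod>i\<in>I. poly_eval (f i) x)"
  by (induction I rule: infinite_finite_induct) auto

lemma in_zariski_closure_of:
  "x \<in> zariski closure_of S \<longleftrightarrow>
    (\<forall>p. (\<forall>y\<in>S. poly_eval p y = 0) \<longrightarrow> poly_eval p x = 0)"
proof
  assume x: "x \<in> zariski closure_of S"
  show "\<forall>p. (\<forall>y\<in>S. poly_eval p y = 0) \<longrightarrow> poly_eval p x = 0"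
  proof (intro allI impI)
    fix p :: "'a cpoly" assume "\<forall>y\<in>S. poly_eval p y = 0"
    then have "zariski closure_of S \<subseteq> zero_locus {p}"
      by (intro closure_of_minimal) (auto simp: zero_locus_def closedin_zariski)
    then show "poly_eval p x = 0"
      using x by (auto simp: zero_locus_def)
  qed
next
  assume x: "\<forall>p. (\<forall>y\<in>S. poly_eval p y = 0) \<longrightarrow> poly_eval p x = 0"
  obtain P where P: "zariski closure_of S = zero_locus P"
    using closedin_closure_of closedin_zariski by metis
  have "S \<subseteq> zero_locus P"
    using closure_of_subset[of S zariski] P by simp
  then show "x \<in> zariski closure_of S"
    using x unfolding P by (force simp: zero_locus_def)
qed

section \<open>Irreducibility\<close>

definition prime_vanishing_ideal :: "(complex^'n::finite) set \<Rightarrow> bool" where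
  "prime_vanishing_ideal S \<longleftrightarrow> S \<noteq> {} \<and>
     (\<forall>p q. (\<forall>x\<in>S. poly_eval p x * poly_eval q x = 0) \<longrightarrow>
        (\<forall>x\<in>S. poly_eval p x = 0) \<or> (\<forall>x\<in>S. poly_eval q x = 0))"

text \<open>
  A set and its Zariski closure have the same vanishing ideal, so irreducibility of the closure
  can be read off from the set itself.
\<close>

lemma prime_vanishing_ideal_closure:
  assumes "prime_vanishing_ideal S"
  shows "irreducible_space (subtopology zariski (zariski closure_of S))"
proof -
  let ?Z = "zariski closure_of S"
  have SZ: "S \<subseteq> ?Z" by (simp add: closure_of_subset)
  have "?Z = C \<or> ?Z = D"
    if C: "closedin (subtopology zariski ?Z) C" and D: "closedin (subtopology zariski ?Z) D"
      and CD: "?Z = C \<union> D" for C D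
  proof (rule ccontr)
    have "closedin zariski C" "closedin zariski D"
      using C D closedin_closed_subtopology[OF closedin_closure_of] by blast+
    then obtain P Q where PQ: "C = zero_locus P" "D = zero_locus Q"
      by (auto simp: closedin_zariski)
    assume "\<not> (?Z = C \<or> ?Z = D)"
    then obtain y z where yz: "y \<in> ?Z" "y \<notin> zero_locus P" "z \<in> ?Z" "z \<notin> zero_locus Q"
      using CD PQ by blast
    then obtain p q where pq: "p \<in> P" "poly_eval p y \<noteq> 0" "q \<in> Q" "poly_eval q z \<noteq> 0"
      by (auto simp: zero_locus_def)
    have "\<forall>x\<in>S. poly_eval p x * poly_eval q x = 0"
      using SZ CD PQ pq by (force simp: zero_locus_def)
    then have "(\<forall>x\<in>S. poly_eval p x = 0) \<or> (\<forall>x\<in>S. poly_eval q x = 0)"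
      using assms by (auto simp: prime_vanishing_ideal_def)
    with pq yz show False
      by (auto simp: in_zariski_closure_of)
  qed
  moreover have "?Z \<noteq> {}"
    using assms SZ by (auto simp: prime_vanishing_ideal_def)
  ultimately show ?thesis
    unfolding irreducible_space_def topspace_subtopology topspace_zariski Int_UNIV_left by blast
qed

lemma irreducible_prime_vanishing_ideal:
  assumes "irreducible_space (subtopology zariski Z)"
  shows "prime_vanishing_ideal Z"
  unfolding prime_vanishing_ideal_def
proof (intro conjI allI impI)
  show "Z \<noteq> {}" using assms by (simp add: irreducible_space_def)
next
  fix p q :: "'a cpoly"
  assume pq: "\<forall>x\<in>Z. poly_eval p x * poly_eval q x = 0"
  have cl: "closedin (subtopology zariski Z) (zero_locus {r} \<inter> Z)" for r
    unfolding closedin_subtopology closedin_zariski by blast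
  have "Z = (zero_locus {p} \<inter> Z) \<union> (zero_locus {q} \<inter> Z)"
    using pq by (auto simp: zero_locus_def)
  then have "Z = zero_locus {p} \<inter> Z \<or> Z = zero_locus {q} \<inter> Z"
    using assms cl unfolding irreducible_space_def topspace_subtopology topspace_zariski Int_UNIV_left
    by blast
  then show "(\<forall>x\<in>Z. poly_eval p x = 0) \<or> (\<forall>x\<in>Z. poly_eval q x = 0)"
    by (auto simp: zero_locus_def)
qed

text \<open>
  Where \<open>f\<close> does not vanish, which is a nonempty open set, \<open>g\<close> must vanish; the identity theorem
  does the rest.
\<close>

lemma entire_mult_eq_0:
  assumes f: "f holomorphic_on UNIV" and g: "g holomorphic_on UNIV"
    and fg: "\<And>z. f z * g z = 0" and a: "f a \<noteq> 0"
  shows "g z = 0"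
proof -
  let ?U = "{z. f z \<noteq> 0}"
  have "open ?U"
    using holomorphic_on_imp_continuous_on[OF f] by (simp add: open_Collect_neq)
  then show ?thesis
    using analytic_continuation_open[of ?U UNIV g "\<lambda>_. 0"] g a fg by auto
qed

text \<open>
  If \<open>p\<close> does not vanish at the image of \<open>u\<close> nor \<open>q\<close> at the image of \<open>v\<close>, then on the complex line
  through \<open>u\<close> and \<open>v\<close> both pullbacks are nonzero entire functions of one variable, and so is
  their product. Only lines are needed, so the domain may be any affine subspace.
\<close>

lemma prime_vanishing_ideal_cos_map:
  fixes A :: "nat^'n^'m"
  assumes "W \<noteq> {}" and line: "\<And>u v s. u \<in> W \<Longrightarrow> v \<in> W \<Longrightarrow> (\<chi> i. u $ i + s * (v $ i - u $ i)) \<in> W"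
  shows "prime_vanishing_ideal (cos_map A ` W)"
  unfolding prime_vanishing_ideal_def
proof (intro conjI allI impI)
  show "cos_map A ` W \<noteq> {}" using assms by simp
next
  fix p q :: "'n cpoly"
  assume pq: "\<forall>x\<in>cos_map A ` W. poly_eval p x * poly_eval q x = 0"
  show "(\<forall>x\<in>cos_map A ` W. poly_eval p x = 0) \<or> (\<forall>x\<in>cos_map A ` W. poly_eval q x = 0)"
  proof (rule ccontr)
    assume "\<not> ?thesis"
    then obtain u v where uv: "u \<in> W" "v \<in> W" and
      p: "poly_eval p (cos_map A u) \<noteq> 0" and q: "poly_eval q (cos_map A v) \<noteq> 0"
      by blast
    define l where "l s = (\<chi> i. u $ i + s * (v $ i - u $ i))" for s
    have l: "l s \<in> W" for s
      unfolding l_def by (rule line[OF uv])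
    have l01: "l 0 = u" "l 1 = v"
      by (simp_all add: l_def vec_eq_iff)
    have hol: "(\<lambda>s. poly_eval r (cos_map A (l s))) holomorphic_on UNIV" for r
      by (rule poly_eval_closed_class[where P = "\<lambda>f. f holomorphic_on UNIV"])
        (auto intro!: holomorphic_intros simp: cos_map_def l_def)
    have "poly_eval q (cos_map A (l 1)) = 0"
      by (rule entire_mult_eq_0[OF hol[of p] hol[of q], where a = 0]) (use pq l p l01 in auto)
    then show False using q l01 by simp
  qed
qed

section \<open>Algebraic independence along chains\<close>

definition exponents :: "nat \<Rightarrow> nat \<Rightarrow> nat list set" where
  "exponents k N = {\<alpha>. set \<alpha> \<subseteq> {..N} \<and> length \<alpha> = k}"

lemma finite_exponents [simp]: "finite (exponents k N)"
  unfolding exponents_def by (rule finite_lists_length_eq) simp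

lemma card_exponents: "card (exponents k N) = (N + 1) ^ k"
  by (simp add: exponents_def card_lists_length_eq)

lemma exponents_Suc: "exponents (Suc k) N = (\<lambda>(j, \<alpha>). j # \<alpha>) ` ({..N} \<times> exponents k N)"
  by (auto simp: exponents_def length_Suc_conv image_iff)

lemma sum_exponents_Suc:
  "(\<Sum>\<alpha>\<in>exponents (Suc k) N. f \<alpha>) = (\<Sum>j\<le>N. \<Sum>\<alpha>\<in>exponents k N. f (j # \<alpha>))"
proof -
  have "inj_on (\<lambda>(j, \<alpha>). j # \<alpha>) ({..N} \<times> exponents k N)"
    by (auto simp: inj_on_def)
  then show ?thesis
    unfolding exponents_Suc
    by (subst sum.reindex) (simp_all add: sum.cartesian_product case_prod_unfold)
qed

lemma exponents_0 [simp]: "exponents 0 N = {[]}"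
  by (auto simp: exponents_def)

definition monomial_in :: "'n::finite cpoly list \<Rightarrow> nat list \<Rightarrow> 'n cpoly" where
  "monomial_in fs \<alpha> = prod_list (map2 (^) fs \<alpha>)"

lemma monomial_in_Nil [simp]: "monomial_in [] \<alpha> = 1"
  by (simp add: monomial_in_def)

lemma monomial_in_Cons [simp]: "monomial_in (f # fs) (j # \<alpha>) = f ^ j * monomial_in fs \<alpha>"
  by (simp add: monomial_in_def)

text \<open>
  Algebraic independence of the restrictions of the polynomials to a set: a polynomial relation
  between them is given by its coefficients \<open>c\<close>, indexed by exponent lists in a box of side \<open>N\<close>.
\<close>

definition alg_independent_on :: "'n::finite cpoly list \<Rightarrow> (complex^'n) set \<Rightarrow> bool" where
  "alg_independent_on fs Z \<longleftrightarrow> (\<forall>N c.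
     (\<forall>x\<in>Z. (\<Sum>\<alpha>\<in>exponents (length fs) N. c \<alpha> * poly_eval (monomial_in fs \<alpha>) x) = 0) \<longrightarrow>
     (\<forall>\<alpha>\<in>exponents (length fs) N. c \<alpha> = 0))"

lemma alg_independent_on_Nil: "Z \<noteq> {} \<Longrightarrow> alg_independent_on [] Z"
  by (auto simp: alg_independent_on_def)

text \<open>
  A polynomial relation between \<open>g\<close> and \<open>fs\<close> on \<open>Z'\<close> has the form \<open>\<Sum>j. g\<^sup>j h\<^sub>j = 0\<close>, with each \<open>h\<^sub>j\<close> a
  polynomial in \<open>fs\<close>. If \<open>j\<close> is least with \<open>h\<^sub>j\<close> nontrivial, the factor \<open>g\<^sup>j\<close> can be cancelled on
  \<open>Z'\<close> by primality; restricting the rest to \<open>Z\<close>, where \<open>g = 0\<close>, leaves \<open>h\<^sub>j = 0\<close> on \<open>Z\<close>,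
  contradicting the independence of \<open>fs\<close> there.
\<close>

lemma alg_independent_on_Cons:
  assumes prime: "prime_vanishing_ideal Z'" and ZZ': "Z \<subseteq> Z'"
    and ind: "alg_independent_on fs Z"
    and gZ: "\<And>x. x \<in> Z \<Longrightarrow> poly_eval g x = 0"
    and y: "y \<in> Z'" "poly_eval g y \<noteq> 0"
  shows "alg_independent_on (g # fs) Z'"
  unfolding alg_independent_on_def length_Cons
proof (intro allI impI)
  fix N :: nat and c :: "nat list \<Rightarrow> complex"
  assume rel: "\<forall>x\<in>Z'. (\<Sum>\<alpha>\<in>exponents (Suc (length fs)) N.
      c \<alpha> * poly_eval (monomial_in (g # fs) \<alpha>) x) = 0"
  let ?E = "exponents (length fs) N"
  define h where "h j = (\<Sum>\<alpha>\<in>?E. const_poly (c (j # \<alpha>)) * monomial_in fs \<alpha>)" for j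
  have h: "poly_eval (h j) x = (\<Sum>\<alpha>\<in>?E. c (j # \<alpha>) * poly_eval (monomial_in fs \<alpha>) x)" for j x
    by (simp add: h_def poly_eval_sum)
  have rel': "(\<Sum>j\<le>N. poly_eval g x ^ j * poly_eval (h j) x) = 0" if "x \<in> Z'" for x
    using bspec[OF rel that] unfolding sum_exponents_Suc
    by (simp add: h sum_distrib_left mult_ac)
  have coeffs: "\<forall>\<alpha>\<in>?E. c (j # \<alpha>) = 0" if "j \<le> N" for j
    using that
  proof (induction j rule: less_induct)
    case (less j)
    \<comment> \<open>The relation divided by \<open>g ^ j\<close>.\<close>
    define q where "q = (\<Sum>i=j..N. g ^ (i - j) * h i)"
    have low: "poly_eval (h i) x = 0" if "i < j" for i x
      using less that by (simp add: h)
    have "poly_eval (g ^ j) x * poly_eval q x = 0" if x: "x \<in> Z'" for x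
    proof -
      have "poly_eval (g ^ j) x * poly_eval q x =
          (\<Sum>i=j..N. poly_eval g x ^ i * poly_eval (h i) x)"
        unfolding q_def poly_eval_sum sum_distrib_left
        by (intro sum.cong refl) (auto simp flip: mult.assoc power_add)
      also have "\<dots> = (\<Sum>i\<le>N. poly_eval g x ^ i * poly_eval (h i) x)"
        by (intro sum.mono_neutral_left) (auto simp: low)
      finally show ?thesis using rel'[OF x] by simp
    qed
    moreover have "poly_eval (g ^ j) y \<noteq> 0" using y by simp
    ultimately have "\<forall>x\<in>Z'. poly_eval q x = 0"
      using prime y(1) unfolding prime_vanishing_ideal_def by blast
    moreover have "poly_eval q x = poly_eval (h j) x" if "x \<in> Z" for x
    proof -
      have "poly_eval q x = (\<Sum>i=j..N. if i = j then poly_eval (h j) x else 0)"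
        unfolding q_def poly_eval_sum by (intro sum.cong) (auto simp: gZ[OF that])
      then show ?thesis using less.prems by simp
    qed
    ultimately have "\<forall>x\<in>Z. poly_eval (h j) x = 0"
      using ZZ' by fastforce
    then show ?case
      using ind[unfolded alg_independent_on_def, rule_format, of "\<lambda>\<alpha>. c (j # \<alpha>)" N] by (simp add: h)
  qed
  show "\<forall>\<alpha>\<in>exponents (Suc (length fs)) N. c \<alpha> = 0"
    unfolding exponents_Suc using coeffs by auto
qed

text \<open>
  The polynomial added at each step vanishes on the smaller set but not on the larger one.
\<close>

lemma chain_alg_independent:
  assumes Z: "\<And>i. i \<le> k \<Longrightarrow> closedin zariski (Z i) \<and> prime_vanishing_ideal (Z i)"
    and strict: "\<And>i. i < k \<Longrightarrow> Z i \<subset> Z (Suc i)"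
  shows "\<exists>fs. length fs = k \<and> alg_independent_on fs (Z k)"
  using assms
proof (induction k)
  case 0
  then have "alg_independent_on [] (Z 0)"
    by (intro alg_independent_on_Nil) (simp add: prime_vanishing_ideal_def)
  then show ?case by auto
next
  case (Suc k)
  then obtain fs where fs: "length fs = k" "alg_independent_on fs (Z k)"
    by auto
  obtain y where y: "y \<in> Z (Suc k)" "y \<notin> Z k"
    using Suc.prems(2)[of k] by blast
  obtain P where "Z k = zero_locus P"
    using Suc.prems(1)[of k] by (auto simp: closedin_zariski)
  then obtain g where "poly_eval g y \<noteq> 0" "\<And>x. x \<in> Z k \<Longrightarrow> poly_eval g x = 0"
    using y by (auto simp: zero_locus_def)
  then have "alg_independent_on (g # fs) (Z (Suc k))"
    using alg_independent_on_Cons[of "Z (Suc k)" "Z k" fs g y] Suc.prems fs y by force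
  then show ?case using fs by (metis length_Cons)
qed

text \<open>
  Gaussian elimination: an equation with a nonzero coefficient at \<open>l\<close> is used to eliminate the
  unknown \<open>l\<close> from the others.
\<close>

lemma underdetermined_system:
  fixes a :: "'e \<Rightarrow> 'k \<Rightarrow> 'a::field"
  assumes "finite E" "finite K" "card E < card K"
  shows "\<exists>c. (\<exists>k\<in>K. c k \<noteq> 0) \<and> (\<forall>e\<in>E. (\<Sum>k\<in>K. a e k * c k) = 0)"
  using assms
proof (induction E arbitrary: K a rule: finite_induct)
  case empty
  then have "\<exists>k\<in>K. (1::'a) \<noteq> 0" by (auto simp: card_gt_0_iff)
  then show ?case by (intro exI[of _ "\<lambda>_. 1"]) auto
next
  case (insert e E)
  show ?case
  proof (cases "\<forall>k\<in>K. a e k = 0")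
    case True
    then show ?thesis
      using insert.IH[of K a] insert by auto
  next
    case False
    then obtain l where l: "l \<in> K" "a e l \<noteq> 0" by auto
    let ?K = "K - {l}"
    have "finite ?K" "card E < card ?K"
      using insert.prems insert.hyps l by (auto simp: card_Diff_singleton)
    then obtain c where c: "\<exists>k\<in>?K. c k \<noteq> 0"
      and ceq: "\<And>e'. e' \<in> E \<Longrightarrow> (\<Sum>k\<in>?K. (a e' k - a e' l * a e k / a e l) * c k) = 0"
      using insert.IH[of ?K "\<lambda>e' k. a e' k - a e' l * a e k / a e l"] by blast
    define c' where "c' = c(l := - (\<Sum>k\<in>?K. a e k * c k) / a e l)"
    have c'l: "c' l = - (\<Sum>k\<in>?K. a e k * c k) / a e l"
      by (simp add: c'_def)
    have split: "(\<Sum>k\<in>K. a e' k * c' k) = (\<Sum>k\<in>?K. a e' k * c k) + a e' l * c' l" for e'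
    proof -
      have "(\<Sum>k\<in>K. a e' k * c' k) = a e' l * c' l + (\<Sum>k\<in>?K. a e' k * c' k)"
        using l insert.prems by (simp add: sum.remove)
      also have "(\<Sum>k\<in>?K. a e' k * c' k) = (\<Sum>k\<in>?K. a e' k * c k)"
        by (intro sum.cong) (auto simp: c'_def)
      finally show ?thesis by simp
    qed
    have "(\<Sum>k\<in>K. a e' k * c' k) = 0" if "e' \<in> E" for e'
    proof -
      have "(\<Sum>k\<in>?K. (a e' k - a e' l * a e k / a e l) * c k) =
          (\<Sum>k\<in>?K. a e' k * c k) - a e' l / a e l * (\<Sum>k\<in>?K. a e k * c k)"
        by (simp add: algebra_simps sum_subtractf sum_distrib_left)
      then show ?thesis
        using ceq[OF that] by (simp add: split c'l)
    qed
    moreover have "(\<Sum>k\<in>K. a e k * c' k) = 0"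
      using l by (simp add: split c'l)
    moreover have "\<exists>k\<in>K. c' k \<noteq> 0"
      using c by (auto simp: c'_def)
    ultimately show ?thesis by blast
  qed
qed

section \<open>Trigonometric sums and the upper bound for the dimension\<close>

definition frequencies :: "nat^'n^'m \<Rightarrow> nat \<Rightarrow> (int^'m) set" where
  "frequencies A M = (\<lambda>c. \<chi> i. \<Sum>j\<in>UNIV. int (A $ i $ j) * c $ j) ` {c. \<forall>j. \<bar>c $ j\<bar> \<le> int M}"

text \<open>
  A vector \<open>A c\<close> is determined by its entries at \<open>r\<close> rows that span the row space, and each such
  entry is an integer of absolute value at most \<open>M C\<close>, where \<open>C\<close> is the sum of all entries of \<open>A\<close>.
\<close>

lemma finite_card_frequencies:
  fixes A :: "nat^'n^'m"
  shows "\<exists>C. \<forall>M. finite (frequencies A M) \<and>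
    card (frequencies A M) \<le> (2 * M * C + 1) ^ rank (map_matrix real A)"
proof -
  let ?R = "map_matrix real A"
  obtain B where B: "B \<subseteq> rows ?R" "independent B" "rows ?R \<subseteq> span B" "card B = dim (rows ?R)"
    using basis_exists by blast
  have "\<forall>b\<in>B. \<exists>i. b = row i ?R"
    using B(1) by (auto simp: rows_def)
  then obtain ix where ix: "\<And>b. b \<in> B \<Longrightarrow> b = row (ix b) ?R"
    by metis
  define I where "I = ix ` B"
  have "inj_on ix B"
    using ix by (metis inj_onI)
  then have cardI: "card I = rank ?R"
    by (simp add: I_def card_image B(4) row_rank_def)
  define C where "C = (\<Sum>i\<in>UNIV. \<Sum>j\<in>UNIV. A $ i $ j)"
  have "finite (frequencies A M) \<and> card (frequencies A M) \<le> (2 * M * C + 1) ^ rank ?R" for M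
  proof -
    let ?K = "{- int (M * C)..int (M * C)}"
    let ?pr = "\<lambda>b :: int^'m. restrict (\<lambda>i. b $ i) I"
    have entry: "\<bar>\<Sum>j\<in>UNIV. int (A $ i $ j) * c $ j\<bar> \<le> int (M * C)"
      if c: "\<forall>j. \<bar>c $ j\<bar> \<le> int M" for c :: "int^'n" and i
    proof -
      have "\<bar>\<Sum>j\<in>UNIV. int (A $ i $ j) * c $ j\<bar> \<le> (\<Sum>j\<in>UNIV. int (A $ i $ j) * int M)"
        using c by (intro order.trans[OF sum_abs] sum_mono) (auto simp: abs_mult intro: mult_left_mono)
      also have "\<dots> = int M * int (\<Sum>j\<in>UNIV. A $ i $ j)"
        by (simp add: sum_distrib_left mult.commute)
      also have "\<dots> \<le> int M * int C"
        unfolding C_def by (intro mult_left_mono) (auto intro!: member_le_sum simp flip: of_nat_sum)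
      finally show ?thesis by simp
    qed
    have maps: "?pr ` frequencies A M \<subseteq> PiE I (\<lambda>_. ?K)"
    proof (clarsimp simp: frequencies_def)
      fix c :: "int^'n" and i assume "\<forall>j. \<bar>c $ j\<bar> \<le> int M"
      from entry[OF this, of i]
      show "- (int M * int C) \<le> (\<Sum>j\<in>UNIV. int (A $ i $ j) * c $ j) \<and>
          (\<Sum>j\<in>UNIV. int (A $ i $ j) * c $ j) \<le> int M * int C"
        by auto
    qed
    have inj: "inj_on ?pr (frequencies A M)"
    proof (rule inj_onI)
      fix b b' assume bb': "b \<in> frequencies A M" "b' \<in> frequencies A M" "?pr b = ?pr b'"
      then obtain c c' where c: "b = (\<chi> i. \<Sum>j\<in>UNIV. int (A $ i $ j) * c $ j)"
        "b' = (\<chi> i. \<Sum>j\<in>UNIV. int (A $ i $ j) * c' $ j)"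
        by (auto simp: frequencies_def)
      \<comment> \<open>The difference of the coefficient vectors is orthogonal to the spanning rows, hence to all.\<close>
      define d :: "real^'n" where "d = (\<chi> j. real_of_int (c $ j - c' $ j))"
      have dot: "row i ?R \<bullet> d = real_of_int (b $ i - b' $ i)" for i
        by (simp add: c d_def inner_vec_def row_def map_matrix_def algebra_simps sum_subtractf)
      have "orthogonal d v" if "v \<in> B" for v
      proof -
        have "b $ ix v = b' $ ix v"
          using fun_cong[OF bb'(3), of "ix v"] that by (simp add: I_def)
        then show ?thesis
          using dot[of "ix v"] ix[OF that] by (simp add: orthogonal_def inner_commute)
      qed
      then have "orthogonal d v" if "v \<in> span B" for v
        using orthogonal_to_span that by blast
      then have "row i ?R \<bullet> d = 0" for i
        using B(3) unfolding rows_def orthogonal_def by (subst inner_commute) blast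
      then show "b = b'"
        by (simp add: dot vec_eq_iff)
    qed
    have finP: "finite (PiE I (\<lambda>_. ?K))"
      by (intro finite_PiE) auto
    have "finite (frequencies A M)"
      using inj maps finP by (metis finite_imageD finite_subset)
    moreover have "card (frequencies A M) \<le> card (PiE I (\<lambda>_. ?K))"
      using inj maps finP by (rule card_inj_on_le)
    moreover have "card (PiE I (\<lambda>_. ?K)) = (2 * M * C + 1) ^ card I"
      by (simp add: card_PiE nat_add_distrib nat_mult_distrib mult_ac)
    ultimately show ?thesis
      by (simp add: cardI)
  qed
  then show ?thesis by blast
qed

definition character :: "int^'m \<Rightarrow> complex^'m \<Rightarrow> complex" where
  "character b u = exp (\<i> * (\<Sum>i\<in>UNIV. of_int (b $ i) * u $ i))"

lemma character_mult: "character b u * character b' u = character (b + b') u"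
  by (simp add: character_def sum.distrib algebra_simps flip: exp_add)

definition trig_span :: "nat^'n^'m \<Rightarrow> nat \<Rightarrow> (complex^'m \<Rightarrow> complex) set" where
  "trig_span A M = {h. \<exists>d. \<forall>u. h u = (\<Sum>b\<in>frequencies A M. d b * character b u)}"

lemma finite_frequencies: "finite (frequencies A M)"
  using finite_card_frequencies by blast

lemma frequencies_add:
  assumes "b \<in> frequencies A M" "b' \<in> frequencies A M'"
  shows "b + b' \<in> frequencies A (M + M')"
proof -
  obtain c c' where c: "\<forall>j. \<bar>c $ j\<bar> \<le> int M" "\<forall>j. \<bar>c' $ j\<bar> \<le> int M'"
    "b = (\<chi> i. \<Sum>j\<in>UNIV. int (A $ i $ j) * c $ j)" "b' = (\<chi> i. \<Sum>j\<in>UNIV. int (A $ i $ j) * c' $ j)"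
    using assms by (auto simp: frequencies_def)
  have "\<forall>j. \<bar>(c + c') $ j\<bar> \<le> int (M + M')"
  proof
    fix j show "\<bar>(c + c') $ j\<bar> \<le> int (M + M')"
      using c(1,2)[rule_format, of j] by simp
  qed
  moreover have "b + b' = (\<chi> i. \<Sum>j\<in>UNIV. int (A $ i $ j) * (c + c') $ j)"
    by (simp add: c vec_eq_iff algebra_simps sum.distrib)
  ultimately show ?thesis
    unfolding frequencies_def by blast
qed

lemma frequencies_mono: "M \<le> M' \<Longrightarrow> frequencies A M \<subseteq> frequencies A M'"
  unfolding frequencies_def by (intro image_mono Collect_mono) (meson of_nat_mono order_trans)

lemma zero_in_frequencies: "0 \<in> frequencies A M"
  unfolding frequencies_def by (rule image_eqI[of _ _ 0]) (auto simp: vec_eq_iff)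

lemma character_in_trig_span:
  assumes "b \<in> frequencies A M"
  shows "(\<lambda>u. a * character b u) \<in> trig_span A M"
proof -
  have "a * character b u = (\<Sum>b'\<in>frequencies A M. (if b' = b then a else 0) * character b' u)" for u
    using assms by (simp add: finite_frequencies if_distrib[of "\<lambda>x. x * _"] cong: if_cong)
  then show ?thesis
    unfolding trig_span_def by (intro CollectI exI allI)
qed

lemma trig_span_add:
  assumes "f \<in> trig_span A M" "g \<in> trig_span A M"
  shows "(\<lambda>u. f u + g u) \<in> trig_span A M"
proof -
  obtain d e where "\<And>u. f u = (\<Sum>b\<in>frequencies A M. d b * character b u)"
    "\<And>u. g u = (\<Sum>b\<in>frequencies A M. e b * character b u)"
    using assms by (auto simp: trig_span_def)
  then have "f u + g u = (\<Sum>b\<in>frequencies A M. (d b + e b) * character b u)" for u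
    by (simp add: algebra_simps sum.distrib)
  then show ?thesis
    unfolding trig_span_def by (intro CollectI exI[of _ "\<lambda>b. d b + e b"]) simp
qed

lemma trig_span_const: "(\<lambda>_. a) \<in> trig_span A M"
  using character_in_trig_span[OF zero_in_frequencies, of a A M] by (simp add: character_def)

lemma trig_span_sum:
  "(\<And>i. i \<in> I \<Longrightarrow> f i \<in> trig_span A M) \<Longrightarrow> (\<lambda>u. \<Sum>i\<in>I. f i u) \<in> trig_span A M"
  by (induction I rule: infinite_finite_induct) (auto intro: trig_span_add trig_span_const)

lemma trig_span_mult:
  assumes "f \<in> trig_span A M" "g \<in> trig_span A M'"
  shows "(\<lambda>u. f u * g u) \<in> trig_span A (M + M')"
proof -
  obtain d e where "\<And>u. f u = (\<Sum>b\<in>frequencies A M. d b * character b u)"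
    "\<And>u. g u = (\<Sum>b\<in>frequencies A M'. e b * character b u)"
    using assms by (auto simp: trig_span_def)
  then have fg: "f u * g u = (\<Sum>b\<in>frequencies A M. \<Sum>b'\<in>frequencies A M'.
      (d b * e b') * character (b + b') u)" for u
    by (simp add: sum_product character_mult[symmetric] mult_ac)
  show ?thesis
    unfolding fg by (intro trig_span_sum character_in_trig_span frequencies_add)
qed

lemma trig_span_mono:
  assumes "M \<le> M'" "f \<in> trig_span A M"
  shows "f \<in> trig_span A M'"
proof -
  obtain d where "\<And>u. f u = (\<Sum>b\<in>frequencies A M. d b * character b u)"
    using assms by (auto simp: trig_span_def)
  then have "f = (\<lambda>u. \<Sum>b\<in>frequencies A M. d b * character b u)" by auto
  also have "\<dots> \<in> trig_span A M'"
    using frequencies_mono[OF assms(1)] by (intro trig_span_sum character_in_trig_span) auto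
  finally show ?thesis .
qed

lemma cos_in_trig_span:
  fixes A :: "nat^'n^'m"
  shows "(\<lambda>u. cos_map A u $ j) \<in> trig_span A 1"
proof -
  define b :: "int^'m" where "b = (\<chi> i. int (A $ i $ j))"
  have sum: "b = (\<chi> i. \<Sum>k\<in>UNIV. int (A $ i $ k) * axis j 1 $ k)"
    "- b = (\<chi> i. \<Sum>k\<in>UNIV. int (A $ i $ k) * axis j (- 1) $ k)"
    by (simp_all add: b_def axis_def if_distrib vec_eq_iff cong: if_cong)
  have freq: "x \<in> frequencies A 1" if "\<forall>k. \<bar>c $ k\<bar> \<le> 1" "x = (\<chi> i. \<Sum>k\<in>UNIV. int (A $ i $ k) * c $ k)"
    for x and c :: "int^'n"
    using that unfolding frequencies_def by auto
  have b: "b \<in> frequencies A 1" "- b \<in> frequencies A 1"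
    by (rule freq[OF _ sum(1)], simp add: axis_def, rule freq[OF _ sum(2)], simp add: axis_def)
  have "cos_map A u $ j = 1/2 * character b u + 1/2 * character (- b) u" for u
    by (simp add: cos_map_def character_def b_def cos_exp_eq sum_negf add_divide_distrib)
  then show ?thesis
    by (simp only:) (intro trig_span_add character_in_trig_span b)
qed

lemma poly_in_trig_span: "\<exists>D. (\<lambda>u. poly_eval p (cos_map A u)) \<in> trig_span A D"
proof (rule poly_eval_closed_class[where P = "\<lambda>f. \<exists>D. f \<in> trig_span A D"])
  fix f g
  assume "\<exists>D. f \<in> trig_span A D" "\<exists>D. g \<in> trig_span A D"
  then obtain D D' where "f \<in> trig_span A D" "g \<in> trig_span A D'" by blast
  then have "(\<lambda>u. f u + g u) \<in> trig_span A (max D D')" "(\<lambda>u. f u * g u) \<in> trig_span A (D + D')"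
    by (intro trig_span_add trig_span_mono[of D "max D D'" f] trig_span_mono[of D' "max D D'" g],
      simp_all) (rule trig_span_mult)
  then show "\<exists>D. (\<lambda>u. f u + g u) \<in> trig_span A D" "\<exists>D. (\<lambda>u. f u * g u) \<in> trig_span A D"
    by blast+
next
  show "\<exists>D. (\<lambda>_. c) \<in> trig_span A D" for c
    using trig_span_const by (rule exI)
  show "\<exists>D. (\<lambda>u. cos_map A u $ j) \<in> trig_span A D" for j
    using cos_in_trig_span by (rule exI)
qed

lemma trig_span_power:
  "f \<in> trig_span A D \<Longrightarrow> (\<lambda>u. f u ^ j) \<in> trig_span A (j * D)"
  by (induction j) (auto intro: trig_span_const trig_span_mult)

lemma monomial_in_trig_span:
  assumes "\<And>f. f \<in> set fs \<Longrightarrow> (\<lambda>u. poly_eval f (cos_map A u)) \<in> trig_span A D"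
    and "\<alpha> \<in> exponents (length fs) N"
  shows "(\<lambda>u. poly_eval (monomial_in fs \<alpha>) (cos_map A u)) \<in> trig_span A (length fs * (N * D))"
  using assms
proof (induction fs arbitrary: \<alpha>)
  case Nil
  then show ?case by (simp add: trig_span_const)
next
  case (Cons f fs)
  then obtain j \<beta> where \<alpha>: "\<alpha> = j # \<beta>" "j \<le> N" "\<beta> \<in> exponents (length fs) N"
    by (auto simp: exponents_Suc)
  have "(\<lambda>u. poly_eval f (cos_map A u) ^ j) \<in> trig_span A (N * D)"
    by (rule trig_span_mono[OF _ trig_span_power]) (use Cons.prems \<alpha> in auto)
  moreover have "(\<lambda>u. poly_eval (monomial_in fs \<beta>) (cos_map A u)) \<in> trig_span A (length fs * (N * D))"
    using Cons \<alpha> by simp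
  ultimately show ?case
    using trig_span_mult by (fastforce simp: \<alpha>)
qed

text \<open>
  If there were \<open>k > r\<close> independent polynomials, the \<open>(N + 1)\<^sup>k\<close> monomials in them would be linear
  combinations of fewer exponentials once \<open>N\<close> is large. The resulting linear system for the
  coefficients of a relation is underdetermined, hence a nontrivial relation exists.
\<close>

lemma alg_independent_le_rank:
  fixes A :: "nat^'n^'m"
  assumes ind: "alg_independent_on fs (range (cos_map A))"
  shows "length fs \<le> rank (map_matrix real A)"
proof (rule ccontr)
  let ?r = "rank (map_matrix real A)" and ?k = "length fs"
  assume "\<not> ?thesis"
  then have kr: "Suc ?r \<le> ?k" by simp
  have "\<exists>D. \<forall>f\<in>set gs. (\<lambda>u. poly_eval f (cos_map A u)) \<in> trig_span A D" for gs
  proof (induction gs)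
    case (Cons g gs)
    then obtain D where D: "\<forall>f\<in>set gs. (\<lambda>u. poly_eval f (cos_map A u)) \<in> trig_span A D" by blast
    obtain D' where D': "(\<lambda>u. poly_eval g (cos_map A u)) \<in> trig_span A D'"
      using poly_in_trig_span by blast
    show ?case
      by (rule exI[of _ "max D D'"]) (use D D' in \<open>auto intro: trig_span_mono[of D] trig_span_mono[of D']\<close>)
  qed auto
  then obtain D where D: "\<And>f. f \<in> set fs \<Longrightarrow> (\<lambda>u. poly_eval f (cos_map A u)) \<in> trig_span A D"
    by blast
  obtain C where C: "\<And>M. card (frequencies A M) \<le> (2 * M * C + 1) ^ ?r"
    using finite_card_frequencies[of A] by blast
  \<comment> \<open>The number of frequencies is at most \<open>(q (N + 1))\<^sup>r = q\<^sup>r (N + 1)\<^sup>r\<close>, which is below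
    \<open>(N + 1)\<^sup>r\<^sup>+\<^sup>1\<close> as soon as \<open>N \<ge> q\<^sup>r\<close>.\<close>
  define q where "q = 2 * (?k * D) * C + 1"
  define N where "N = q ^ ?r"
  let ?M = "?k * (N * D)" and ?E = "exponents ?k N"
  have "card (frequencies A ?M) \<le> (2 * ?M * C + 1) ^ ?r"
    by (rule C)
  also have "\<dots> \<le> (q * (N + 1)) ^ ?r"
    by (intro power_mono) (auto simp: q_def algebra_simps)
  also have "\<dots> = N * (N + 1) ^ ?r"
    unfolding N_def power_mult_distrib ..
  also have "\<dots> < (N + 1) * (N + 1) ^ ?r"
    by (intro mult_strict_right_mono) auto
  also have "\<dots> = (N + 1) ^ Suc ?r"
    by (rule power_Suc[symmetric])
  also have "\<dots> \<le> (N + 1) ^ ?k"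
    using kr by (intro power_increasing) auto
  finally have less: "card (frequencies A ?M) < card ?E"
    by (simp add: card_exponents)
  have "\<forall>\<alpha>\<in>?E. \<exists>d. \<forall>u. poly_eval (monomial_in fs \<alpha>) (cos_map A u) =
      (\<Sum>b\<in>frequencies A ?M. d b * character b u)"
    using monomial_in_trig_span[OF D, where N = N] unfolding trig_span_def by blast
  then obtain d where d: "\<And>\<alpha> u. \<alpha> \<in> ?E \<Longrightarrow> poly_eval (monomial_in fs \<alpha>) (cos_map A u) =
      (\<Sum>b\<in>frequencies A ?M. d \<alpha> b * character b u)"
    by metis
  obtain c where c: "\<exists>\<alpha>\<in>?E. c \<alpha> \<noteq> 0"
    and c0: "\<And>b. b \<in> frequencies A ?M \<Longrightarrow> (\<Sum>\<alpha>\<in>?E. d \<alpha> b * c \<alpha>) = 0"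
    using underdetermined_system[OF finite_frequencies finite_exponents less, of "\<lambda>b \<alpha>. d \<alpha> b"] by blast
  have "(\<Sum>\<alpha>\<in>?E. c \<alpha> * poly_eval (monomial_in fs \<alpha>) (cos_map A u)) = 0" for u
  proof -
    have "(\<Sum>\<alpha>\<in>?E. c \<alpha> * poly_eval (monomial_in fs \<alpha>) (cos_map A u)) =
        (\<Sum>\<alpha>\<in>?E. \<Sum>b\<in>frequencies A ?M. d \<alpha> b * c \<alpha> * character b u)"
      by (intro sum.cong refl) (simp add: d sum_distrib_left mult_ac)
    also have "\<dots> = (\<Sum>b\<in>frequencies A ?M. (\<Sum>\<alpha>\<in>?E. d \<alpha> b * c \<alpha>) * character b u)"
      by (subst sum.swap) (simp add: sum_distrib_right)
    finally show ?thesis by (simp add: c0)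
  qed
  then have "\<forall>\<alpha>\<in>?E. c \<alpha> = 0"
    using ind unfolding alg_independent_on_def by blast
  with c show False by blast
qed

section \<open>The lower bound for the dimension\<close>

text \<open>
  \<open>W k\<close> is the common kernel of all but the first \<open>k\<close> of \<open>r\<close> independent columns of \<open>A\<close>. The
  witness \<open>j\<close> is the column freed when passing to \<open>W (Suc k)\<close>: by independence that form takes
  the value \<open>pi\<close> at a point where the later ones are 0, and there its cosine is \<open>- 1\<close>.
\<close>

lemma cos_map_subspaces:
  fixes A :: "nat^'n^'m"
  obtains W :: "nat \<Rightarrow> (complex^'m) set" where
    "\<And>k. 0 \<in> W k"
    "\<And>k u v s. u \<in> W k \<Longrightarrow> v \<in> W k \<Longrightarrow> (\<chi> i. u $ i + s * (v $ i - u $ i)) \<in> W k"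
    "\<And>k. W k \<subseteq> W (Suc k)"
    "\<And>k. k < rank (map_matrix real A) \<Longrightarrow>
      \<exists>j. (\<forall>u\<in>W k. cos_map A u $ j = 1) \<and> (\<exists>u\<in>W (Suc k). cos_map A u $ j \<noteq> 1)"
proof -
  define r where "r = rank (map_matrix real A)"
  let ?R = "map_matrix real A"
  obtain B where B: "B \<subseteq> columns ?R" "independent B" "card B = dim (columns ?R)"
    using basis_exists by metis
  have "finite B" using B(2) by (rule finiteI_independent)
  then obtain b where b: "bij_betw b {..<r} B"
    using B(3) ex_bij_betw_nat_finite[of B] by (auto simp: r_def column_rank_def lessThan_atLeast0)
  then have "\<forall>k<r. \<exists>j. b k = column j ?R"
    using B(1) by (auto simp: bij_betw_def columns_def)
  then obtain J where J: "\<And>k. k < r \<Longrightarrow> b k = column (J k) ?R"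
    by metis
  define W :: "nat \<Rightarrow> (complex^'m) set" where
    "W k = {u. \<forall>l. k \<le> l \<longrightarrow> l < r \<longrightarrow> (\<Sum>i\<in>UNIV. of_nat (A $ i $ J l) * u $ i) = 0}" for k
  have neq: "\<exists>u\<in>W (Suc k). cos_map A u $ J k \<noteq> 1" if k: "k < r" for k
  proof -
    obtain g :: "real^'m \<Rightarrow> real" where g: "linear g" "\<And>x. x \<in> B \<Longrightarrow> g x = (if x = b k then pi else 0)"
      using linear_independent_extend[OF B(2), of "\<lambda>x. if x = b k then pi else 0"] by auto
    \<comment> \<open>The vector that represents the functional \<open>g\<close>, so that \<open>a\<^sub>j \<cdot> u = g a\<^sub>j\<close>.\<close>
    define u :: "complex^'m" where "u = (\<chi> i. of_real (g (axis i 1)))"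
    have sum: "(\<Sum>i\<in>UNIV. of_nat (A $ i $ J l) * u $ i) = of_real (g (b l))" if "l < r" for l
    proof -
      have "b l = (\<Sum>i\<in>UNIV. real (A $ i $ J l) *\<^sub>R axis i 1)"
        by (simp add: J[OF that] column_def map_matrix_def vec_eq_iff axis_def if_distrib cong: if_cong)
      then have "g (b l) = (\<Sum>i\<in>UNIV. real (A $ i $ J l) * g (axis i 1))"
        by (simp add: linear_sum[OF g(1)] linear_scale[OF g(1)])
      then show ?thesis
        by (simp add: u_def)
    qed
    have "b l \<noteq> b k" if "Suc k \<le> l" "l < r" for l
      using that k bij_betw_imp_inj_on[OF b] by (auto dest!: inj_onD)
    moreover have bB: "b l \<in> B" if "l < r" for l
      using b that by (auto simp: bij_betw_def)
    ultimately have "u \<in> W (Suc k)"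
      by (auto simp: W_def sum g(2))
    moreover have "cos_map A u $ J k = - 1"
      using bB[OF k] k by (simp add: cos_map_def sum g(2))
    ultimately show ?thesis by (intro bexI[of _ u]) auto
  qed
  have eq: "\<forall>u\<in>W k. cos_map A u $ J k = 1" if "k < r" for k
    using that by (auto simp: W_def cos_map_def)
  have line: "(\<chi> i. u $ i + s * (v $ i - u $ i)) \<in> W k" if "u \<in> W k" "v \<in> W k" for u v s k
  proof -
    have "(\<Sum>i\<in>UNIV. of_nat (A $ i $ j) * (u $ i + s * (v $ i - u $ i))) =
        (1 - s) * (\<Sum>i\<in>UNIV. of_nat (A $ i $ j) * u $ i) +
        s * (\<Sum>i\<in>UNIV. of_nat (A $ i $ j) * v $ i)" for j
      unfolding sum_distrib_left sum.distrib[symmetric] by (intro sum.cong) (auto simp: algebra_simps)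
    then show ?thesis using that by (simp add: W_def)
  qed
  have zero: "0 \<in> W k" and mono: "W k \<subseteq> W (Suc k)" for k
    by (auto simp: W_def)
  show thesis
  proof (rule that[of W])
    show "\<exists>j. (\<forall>u\<in>W k. cos_map A u $ j = 1) \<and> (\<exists>u\<in>W (Suc k). cos_map A u $ j \<noteq> 1)"
      if "k < rank (map_matrix real A)" for k
      using eq[of k] neq[of k] that unfolding r_def by blast
  qed (assumption | rule zero line mono)+
qed

lemma zariski_closure_mono_strict:
  fixes S T :: "(complex^'n) set"
  assumes "S \<subseteq> T" "\<And>x. x \<in> S \<Longrightarrow> x $ j = 1" "y \<in> T" "y $ j \<noteq> 1"
  shows "zariski closure_of S \<subset> zariski closure_of T"
proof -
  have "zariski closure_of S \<subseteq> zariski closure_of T"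
    using assms(1) by (rule closure_of_mono)
  moreover have "y \<in> zariski closure_of T"
    using assms(3) closure_of_subset[of T zariski] by auto
  moreover have "y \<notin> zariski closure_of S"
    unfolding in_zariski_closure_of
    using assms(2,4) by (auto intro!: exI[of _ "coord j + const_poly (- 1)"])
  ultimately show ?thesis by blast
qed

lemma krull_dim_ge_rank:
  fixes A :: "nat^'n^'m"
  shows "enat (rank (map_matrix real A)) \<le> krull_dim (subtopology zariski (cos_chebyshev_variety A))"
proof (rule cos_map_subspaces[of A])
  let ?r = "rank (map_matrix real A)" and ?X = "cos_chebyshev_variety A"
  fix W :: "nat \<Rightarrow> (complex^'m) set"
  assume W0: "\<And>k. 0 \<in> W k"
    and Wline: "\<And>k u v s. u \<in> W k \<Longrightarrow> v \<in> W k \<Longrightarrow> (\<chi> i. u $ i + s * (v $ i - u $ i)) \<in> W k"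
    and Wmono: "\<And>k. W k \<subseteq> W (Suc k)"
    and Wj: "\<And>k. k < ?r \<Longrightarrow>
      \<exists>j. (\<forall>u\<in>W k. cos_map A u $ j = 1) \<and> (\<exists>u\<in>W (Suc k). cos_map A u $ j \<noteq> 1)"
  define Z where "Z k = zariski closure_of (cos_map A ` W k)" for k
  have ZX: "Z k \<subseteq> ?X" for k
    unfolding Z_def cos_chebyshev_variety_def by (intro closure_of_mono) auto
  have "irreducible_space (subtopology zariski (Z k))" for k
    unfolding Z_def using W0 Wline
    by (intro prime_vanishing_ideal_closure prime_vanishing_ideal_cos_map) blast+
  then have "closedin (subtopology zariski ?X) (Z k) \<and>
      irreducible_space (subtopology (subtopology zariski ?X) (Z k))" for k
    using ZX[of k] by (simp add: subtopology_subtopology Int_absorb1 Z_def closedin_subset_topspace)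
  moreover have "Z k \<subset> Z (Suc k)" if k: "k < ?r" for k
  proof -
    obtain j u where "\<forall>u\<in>W k. cos_map A u $ j = 1" "u \<in> W (Suc k)" "cos_map A u $ j \<noteq> 1"
      using Wj[OF k] by blast
    then show ?thesis
      unfolding Z_def using Wmono[of k]
      by (intro zariski_closure_mono_strict[where j = j and y = "cos_map A u"]) auto
  qed
  ultimately show ?thesis
    unfolding krull_dim_def by (intro SUP_upper CollectI exI[of _ Z]) auto
qed

text \<open>
  A polynomial relation on the image of \<^const>\<open>cos_map\<close> persists on its closure, so independence on
  the top of a chain implies independence on the image, where the rank bounds it.
\<close>

lemma krull_dim_le_rank:
  fixes A :: "nat^'n^'m"
  shows "krull_dim (subtopology zariski (cos_chebyshev_variety A)) \<le> enat (rank (map_matrix real A))"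
  unfolding krull_dim_def
proof (rule SUP_least, clarsimp)
  let ?X = "cos_chebyshev_variety A"
  fix k and Z :: "nat \<Rightarrow> (complex^'n) set"
  assume Z: "\<forall>i\<le>k. closedin (subtopology zariski ?X) (Z i) \<and>
      irreducible_space (subtopology (subtopology zariski ?X) (Z i))"
    and strict: "\<forall>i<k. Z i \<subset> Z (Suc i)"
  have sub: "Z i \<subseteq> ?X" if "i \<le> k" for i
    using Z that closedin_subset by fastforce
  have "closedin zariski ?X"
    by (simp add: cos_chebyshev_variety_def)
  then have "closedin zariski (Z i) \<and> prime_vanishing_ideal (Z i)" if "i \<le> k" for i
    using Z[rule_format, OF that] sub[OF that]
    by (auto simp: subtopology_subtopology Int_absorb1 closedin_closed_subtopology
        intro: irreducible_prime_vanishing_ideal)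
  then obtain fs where fs: "length fs = k" "alg_independent_on fs (Z k)"
    using chain_alg_independent[of k Z] strict by blast
  have "alg_independent_on fs (range (cos_map A))"
    unfolding alg_independent_on_def
  proof (intro allI impI)
    fix N c
    let ?E = "exponents (length fs) N"
    let ?p = "\<Sum>\<alpha>\<in>?E. const_poly (c \<alpha>) * monomial_in fs \<alpha>"
    assume "\<forall>x\<in>range (cos_map A). (\<Sum>\<alpha>\<in>?E. c \<alpha> * poly_eval (monomial_in fs \<alpha>) x) = 0"
    then have "\<forall>x\<in>range (cos_map A). poly_eval ?p x = 0"
      by (simp add: poly_eval_sum)
    then have "poly_eval ?p x = 0" if "x \<in> ?X" for x
      using that unfolding cos_chebyshev_variety_def in_zariski_closure_of by blast
    then have "\<forall>x\<in>Z k. (\<Sum>\<alpha>\<in>?E. c \<alpha> * poly_eval (monomial_in fs \<alpha>) x) = 0"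
      using sub[of k] by (auto simp: poly_eval_sum)
    then show "\<forall>\<alpha>\<in>?E. c \<alpha> = 0"
      using fs(2) unfolding alg_independent_on_def by blast
  qed
  then show "k \<le> rank (map_matrix real A)"
    using alg_independent_le_rank fs(1) by blast
qed

section \<open>The projection of the toric cover\<close>

text \<open>
  The functions on the torus that become polynomial after multiplication by a power of
  \<open>\<Prod>j. y\<^sub>j\<close> are closed under sums and products.
\<close>

lemma clear_denominators:
  fixes p :: "'n::finite cpoly"
  shows "\<exists>N q. \<forall>y. (\<forall>j. y $ j \<noteq> 0) \<longrightarrow>
    poly_eval q y = (\<Prod>j\<in>UNIV. y $ j) ^ N * poly_eval p (\<chi> j. (y $ j + inverse (y $ j)) / 2)"
proof -
  define T where "T = {y :: complex^'n. \<forall>j. y $ j \<noteq> 0}"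
  define \<pi> :: "complex^'n \<Rightarrow> complex" where "\<pi> y = (\<Prod>j\<in>UNIV. y $ j)" for y
  define L where "L f \<longleftrightarrow> (\<exists>N q. \<forall>y\<in>T. poly_eval q y = \<pi> y ^ N * f y)" for f
  define pp where "pp = (\<Prod>j\<in>UNIV. coord j :: 'n cpoly)"
  have pp: "poly_eval pp y = \<pi> y" for y
    by (simp add: pp_def \<pi>_def poly_eval_prod)
  have "L (\<lambda>y. poly_eval p (\<chi> j. (y $ j + inverse (y $ j)) / 2))"
  proof (rule poly_eval_closed_class[of L])
    fix c show "L (\<lambda>_. c)"
      unfolding L_def by (intro exI[of _ 0] exI[of _ "const_poly c"]) simp
  next
    fix f g assume "L f" "L g"
    then obtain N q N' q' where
      *: "\<forall>y\<in>T. poly_eval q y = \<pi> y ^ N * f y" "\<forall>y\<in>T. poly_eval q' y = \<pi> y ^ N' * g y"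
      unfolding L_def by blast
    have "\<forall>y\<in>T. poly_eval (pp ^ N' * q + pp ^ N * q') y = \<pi> y ^ (N + N') * (f y + g y)"
      by (simp add: pp * * power_add algebra_simps)
    then show "L (\<lambda>y. f y + g y)" unfolding L_def by blast
    have "\<forall>y\<in>T. poly_eval (q * q') y = \<pi> y ^ (N + N') * (f y * g y)"
      by (simp add: * power_add algebra_simps)
    then show "L (\<lambda>y. f y * g y)" unfolding L_def by blast
  next
    fix j
    define q where "q = const_poly (1/2) * (\<Prod>i\<in>UNIV - {j}. coord i) * (coord j * coord j + 1 :: 'n cpoly)"
    have "poly_eval q y = \<pi> y ^ 1 * ((\<chi> j. (y $ j + inverse (y $ j)) / 2) $ j)" if "y \<in> T" for y
    proof -
      have "\<pi> y = y $ j * (\<Prod>i\<in>UNIV - {j}. y $ i)"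
        unfolding \<pi>_def by (simp add: prod.remove)
      moreover have "y $ j \<noteq> 0" using that by (simp add: T_def)
      ultimately show ?thesis
        by (simp add: q_def poly_eval_prod field_simps)
    qed
    then show "L (\<lambda>y. (\<chi> j. (y $ j + inverse (y $ j)) / 2) $ j)" unfolding L_def by blast
  qed
  then show ?thesis
    by (auto simp: L_def T_def \<pi>_def)
qed

lemma quadratic_iff:
  fixes x y :: complex
  assumes "y \<noteq> 0"
  shows "y\<^sup>2 - 2 * x * y + 1 = 0 \<longleftrightarrow> x = (y + inverse y) / 2"
  using assms by (auto simp: field_simps power2_eq_square)

lemma cos_map_exp:
  "cos_map A u = (\<chi> j. (monomial_map A (\<chi> i. exp (\<i> * u $ i)) $ j +
     inverse (monomial_map A (\<chi> i. exp (\<i> * u $ i)) $ j)) / 2)"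
proof -
  have "monomial_map A (\<chi> i. exp (\<i> * u $ i)) $ j = exp (\<i> * (\<Sum>i\<in>UNIV. of_nat (A $ i $ j) * u $ i))" for j
    by (simp add: monomial_map_def exp_of_nat_mult[symmetric] exp_sum sum_distrib_left mult_ac)
  then show ?thesis
    by (simp add: cos_map_def vec_eq_iff cos_exp_eq exp_minus)
qed

text \<open>
  A zero coordinate of \<open>t\<close> can occur only with exponent 0 if no monomial vanishes, so replacing
  it by 1 moves \<open>t\<close> into the torus without changing the monomials. Torus points are exponentials.
\<close>

lemma monomial_map_torus:
  assumes "\<And>j. monomial_map A t $ j \<noteq> 0"
  shows "\<exists>u. monomial_map A t = monomial_map A (\<chi> i. exp (\<i> * u $ i))"
proof -
  define u where "u = (\<chi> i. - \<i> * Ln (if t $ i = 0 then 1 else t $ i))"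
  have "t $ i = 0 \<Longrightarrow> A $ i $ j = 0" for i j
    using assms[of j] by (auto simp: monomial_map_def)
  moreover have "exp (\<i> * u $ i) = (if t $ i = 0 then 1 else t $ i)" for i
    by (simp add: u_def flip: mult.assoc)
  ultimately have "monomial_map A t = monomial_map A (\<chi> i. exp (\<i> * u $ i))"
    by (auto simp: monomial_map_def vec_eq_iff intro!: prod.cong)
  then show ?thesis ..
qed

text \<open>
  For the inclusion of the projection, the polynomial cleared of denominators is multiplied by
  \<open>\<Prod>j. y\<^sub>j\<close> once more. The product then vanishes on the whole monomial image, including points
  with zero coordinates, hence on the toric variety, and the extra factor is invertible at \<open>y\<close>.
\<close>

lemma cos_chebyshev_eq_projection:
  fixes A :: "nat^'n^'m"
  shows "cos_chebyshev_variety A = zariski closure_of (fst ` toric_cover A)"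
proof
  have "cos_map A u \<in> fst ` toric_cover A" for u
  proof -
    let ?y = "monomial_map A (\<chi> i. exp (\<i> * u $ i))"
    have "?y \<in> affine_toric_variety A"
      unfolding affine_toric_variety_def using closure_of_subset[of "range (monomial_map A)" zariski] by auto
    moreover have "?y $ j \<noteq> 0" for j
      by (simp add: monomial_map_def)
    moreover have "cos_map A u $ j = (?y $ j + inverse (?y $ j)) / 2" for j
      by (simp add: cos_map_exp)
    ultimately have "(?y $ j)\<^sup>2 - 2 * cos_map A u $ j * ?y $ j + 1 = 0" for j
      by (subst quadratic_iff)
    then have "(cos_map A u, ?y) \<in> toric_cover A"
      unfolding toric_cover_def using \<open>?y \<in> affine_toric_variety A\<close> \<open>\<And>j. ?y $ j \<noteq> 0\<close> by blast
    then show ?thesis by force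
  qed
  then show "cos_chebyshev_variety A \<subseteq> zariski closure_of (fst ` toric_cover A)"
    unfolding cos_chebyshev_variety_def by (intro closure_of_mono) auto
  have "x \<in> cos_chebyshev_variety A" if xy: "(x, y) \<in> toric_cover A" for x y
    unfolding cos_chebyshev_variety_def in_zariski_closure_of
  proof (intro allI impI)
    fix p assume p: "\<forall>z\<in>range (cos_map A). poly_eval p z = 0"
    obtain N q where q: "\<And>y. (\<forall>j. y $ j \<noteq> 0) \<Longrightarrow> poly_eval q y =
        (\<Prod>j\<in>UNIV. y $ j) ^ N * poly_eval p (\<chi> j. (y $ j + inverse (y $ j)) / 2)"
      using clear_denominators[of p] by blast
    have y: "\<forall>j. y $ j \<noteq> 0" "y \<in> affine_toric_variety A"
      and x: "x = (\<chi> j. (y $ j + inverse (y $ j)) / 2)"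
      using xy by (auto simp: toric_cover_def quadratic_iff vec_eq_iff)
    have "poly_eval (q * (\<Prod>j\<in>UNIV. coord j)) (monomial_map A t) = 0" for t
    proof (cases "\<forall>j. monomial_map A t $ j \<noteq> 0")
      case True
      then obtain u where "monomial_map A t = monomial_map A (\<chi> i. exp (\<i> * u $ i))"
        using monomial_map_torus by blast
      then show ?thesis
        using q[OF True] p by (simp flip: cos_map_exp)
    qed (auto simp: poly_eval_prod)
    then have "poly_eval (q * (\<Prod>j\<in>UNIV. coord j)) y = 0"
      using y(2) unfolding affine_toric_variety_def in_zariski_closure_of by blast
    then show "poly_eval p x = 0"
      using y(1) q[OF y(1)] by (simp add: x poly_eval_prod)
  qed
  then have "fst ` toric_cover A \<subseteq> cos_chebyshev_variety A"
    by fastforce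
  then show "zariski closure_of (fst ` toric_cover A) \<subseteq> cos_chebyshev_variety A"
    by (rule closure_of_minimal) (simp add: cos_chebyshev_variety_def)
qed

theorem theorem5p2:
  fixes A :: "nat^'n^'m"
  shows "irreducible_space (subtopology zariski (cos_chebyshev_variety A)) \<and>
    krull_dim (subtopology zariski (cos_chebyshev_variety A)) = enat (rank (map_matrix real A)) \<and>
    cos_chebyshev_variety A = zariski closure_of (fst ` toric_cover A)"
proof (intro conjI)
  show "irreducible_space (subtopology zariski (cos_chebyshev_variety A))"
    unfolding cos_chebyshev_variety_def
    by (intro prime_vanishing_ideal_closure prime_vanishing_ideal_cos_map) auto
  show "krull_dim (subtopology zariski (cos_chebyshev_variety A)) = enat (rank (map_matrix real A))"
    by (intro antisym krull_dim_le_rank krull_dim_ge_rank)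
  show "cos_chebyshev_variety A = zariski closure_of (fst ` toric_cover A)"
    by (rule cos_chebyshev_eq_projection)
qed

end
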